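(* There exists a convex-polyhedral surface $\mathcal{S}$ in $\mathbb{R}^3$ whose adjacency graph $\mathcal{G}(\mathcal{S})$ is isomorphic to the complete bipartite graph $K_{3,5}$.
   Context: A polygon in $\mathbb{R}^3$ is a closed planar region (including its interior) bounded by a simple closed polygonal chain lying in some plane of $\mathbb{R}^3$; its vertices are called corners and its edges are called sides. A polyhedral surface $\mathcal{S}=\{S_1,\dots,S_n\}$ is a set of $n$ closed polygons embedded in $\mathbb{R}^3$ such that, for all pairwise distinct indices $i,j,k$: (1) $S_i$ and $S_j$ are interior-disjoint (with respect to the 2D relative interiors); (2) if $S_i\cap S_j\neq\emptyset$, then $S_i\cap S_j$ is either a single corner or a complete side of both $S_i$ and $S_j$; (3) if $S_i\cap S_j\cap S_k\neq\emptyset$, then it is a single corner (so a side is shared by at most two polygons). Sides need not be shared with another polygon. The adjacency graph $\mathcal{G}(\mathcal{S})$ has one vertex for each polygon of $\mathcal{S}$ and an edge between two vertices if and only if the corresponding polygons share a side (contacts in a single corner do not give an edge). A convex-polyhedral surface is a polyhedral surface all of whose polygons are strictly convex. *)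

theory Defs
  imports "HOL-Analysis.Analysis" "Graph_Theory.Graph_Theory"
begin

fun polygonal_path :: "'a::real_normed_vector list \<Rightarrow> real \<Rightarrow> 'a" where
  "polygonal_path [] = linepath 0 0"
| "polygonal_path [a] = linepath a a"
| "polygonal_path [a, b] = linepath a b"
| "polygonal_path (a # b # c # vs) = linepath a b +++ polygonal_path (b # c # vs)"

text \<open>
  A polygon is given by the list \<open>vs\<close> of its corners in cyclic order. This keeps the corners and
  sides as part of the data, which is necessary because a corner of a general polygon may be flat
  and hence not be determined by the region.
\<close>

definition boundary_path :: "'a::real_normed_vector list \<Rightarrow> real \<Rightarrow> 'a" where
  "boundary_path vs = polygonal_path (vs @ [hd vs])"

text \<open>
  Simplicity of the closed path already forces the corners to be distinct and not all collinear,
  so they span the plane that contains the chain.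
\<close>

definition is_polygon :: "'a::euclidean_space list \<Rightarrow> bool" where
  "is_polygon vs \<longleftrightarrow>
     length vs \<ge> 3 \<and> simple_path (boundary_path vs) \<and> aff_dim (set vs) = 2"

definition corners :: "'a list \<Rightarrow> 'a set" where
  "corners vs = set vs"

definition sides :: "'a::real_normed_vector list \<Rightarrow> 'a set set" where
  "sides vs = {closed_segment (vs ! i) (vs ! (Suc i mod length vs)) | i. i < length vs}"

text \<open>
  The constant \<^const>\<open>inside\<close> cannot be used for the enclosed points: a closed curve
  in three-dimensional space does not separate it. Components are therefore taken in the plane
  of the polygon.
\<close>

definition region :: "'a::euclidean_space list \<Rightarrow> 'a set" where
  "region vs =
     (let C = path_image (boundary_path vs); P = affine hull (set vs)
      in C \<union> {x \<in> P - C. bounded (connected_component_set (P - C) x)})"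

text \<open>All interior angles of a convex polygon are less than \<open>\<pi>\<close> iff all its corners are extreme
  points of the region.\<close>

definition strictly_convex_polygon :: "'a::euclidean_space list \<Rightarrow> bool" where
  "strictly_convex_polygon vs \<longleftrightarrow>
     is_polygon vs \<and> convex (region vs) \<and> (\<forall>v\<in>corners vs. v extreme_point_of region vs)"

text \<open>
  Two different lists for the same region are never both in a polyhedral surface, as
  their relative interiors would coincide and be nonempty.
\<close>

definition polyhedral_surface :: "(real^3) list set \<Rightarrow> bool" where
  "polyhedral_surface \<S> \<longleftrightarrow>
     finite \<S> \<and> (\<forall>S\<in>\<S>. is_polygon S) \<and>
     (\<forall>S\<in>\<S>. \<forall>T\<in>\<S>. S \<noteq> T \<longrightarrow>
        rel_interior (region S) \<inter> rel_interior (region T) = {}) \<and>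
     (\<forall>S\<in>\<S>. \<forall>T\<in>\<S>. S \<noteq> T \<longrightarrow> region S \<inter> region T \<noteq> {} \<longrightarrow>
        (\<exists>v \<in> corners S \<inter> corners T. region S \<inter> region T = {v}) \<or>
        region S \<inter> region T \<in> sides S \<inter> sides T) \<and>
     (\<forall>S\<in>\<S>. \<forall>T\<in>\<S>. \<forall>U\<in>\<S>. S \<noteq> T \<longrightarrow> S \<noteq> U \<longrightarrow> T \<noteq> U \<longrightarrow>
        region S \<inter> region T \<inter> region U \<noteq> {} \<longrightarrow>
        (\<exists>v \<in> corners S \<inter> corners T \<inter> corners U. region S \<inter> region T \<inter> region U = {v}))"

definition convex_polyhedral_surface :: "(real^3) list set \<Rightarrow> bool" where
  "convex_polyhedral_surface \<S> \<longleftrightarrow>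
     polyhedral_surface \<S> \<and> (\<forall>S\<in>\<S>. strictly_convex_polygon S)"

text \<open>Undirected graphs are symmetric loop-free digraphs without parallel arcs.\<close>

definition adjacency_graph :: "(real^3) list set \<Rightarrow> (real^3) list pair_pre_digraph" where
  "adjacency_graph \<S> =
     \<lparr> pverts = \<S>,
       parcs = {(S, T). S \<in> \<S> \<and> T \<in> \<S> \<and> S \<noteq> T \<and> sides S \<inter> sides T \<noteq> {}} \<rparr>"

definition complete_bipartite_graph :: "nat \<Rightarrow> nat \<Rightarrow> (nat + nat) pair_pre_digraph" where
  "complete_bipartite_graph m n =
     (let U = Inl ` {..<m}; V = Inr ` {..<n}
      in \<lparr> pverts = U \<union> V, parcs = U \<times> V \<union> V \<times> U \<rparr>)"

lemma complete_bipartite_graph_correct: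
  "K\<^bsub>m,n\<^esub> (with_proj (complete_bipartite_graph m n))"
proof -
  have "card (Inl ` {..<m} :: (nat + nat) set) = m" "card (Inr ` {..<n} :: (nat + nat) set) = n"
    by (simp_all add: card_image)
  moreover have "Inl ` {..<m} \<inter> Inr ` {..<n} = ({} :: (nat + nat) set)"
    by auto
  ultimately show ?thesis
    unfolding complete_bipartite_digraph_pair_def complete_bipartite_graph_def Let_def
    by (intro conjI exI[of _ "Inl ` {..<m}"] exI[of _ "Inr ` {..<n}"]) simp_all
qed

end

theory Submission
  imports Defs
begin

text \<open>
  Three convex decagons lie in the three coordinate planes, with all nonzero coordinates positive.
  Each of the five hexagons has two consecutive corners in each coordinate plane, these being two
  consecutive corners of the decagon there, and lies otherwise strictly in the positive orthant. So
  it meets each decagon exactly in the common side. Polygons of the same class are disjoint, since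
  a linear functional separates their corners.

  The cyclic permutation of the coordinates permutes the decagons, fixes two of the hexagons, which
  are parallel, and permutes the other three. With this symmetry prescribed, the corners were found
  by a numerical search.

  A cyclic list of points of a plane, each edge of which is the full set of maximizers of a linear
  functional on the convex hull, is the corner list of a strictly convex polygon. This reduces the
  whole verification to finitely many inequalities between integers.
\<close>

section \<open>Convex hulls of finite sets and supporting hyperplanes\<close>

lemma convex_hull_inner_le:
  assumes "\<And>v. v \<in> S \<Longrightarrow> w \<bullet> v \<le> c" "x \<in> convex hull S"
  shows "w \<bullet> x \<le> c"
proof -
  have "convex hull S \<subseteq> {x. w \<bullet> x \<le> c}"
    using assms(1) by (intro hull_minimal) (auto simp: convex_halfspace_le)
  with assms(2) show ?thesis by blast
qed

lemma convex_hull_inner_less: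
  assumes "\<And>v. v \<in> S \<Longrightarrow> w \<bullet> v < c" "x \<in> convex hull S"
  shows "w \<bullet> x < c"
proof -
  have "convex hull S \<subseteq> {x. w \<bullet> x < c}"
    using assms(1) by (intro hull_minimal) (auto simp: convex_halfspace_lt)
  with assms(2) show ?thesis by blast
qed

lemma convex_hull_inner_gt:
  assumes "\<And>v. v \<in> S \<Longrightarrow> c < w \<bullet> v" "x \<in> convex hull S"
  shows "c < w \<bullet> x"
  using convex_hull_inner_less[of S "- w" "- c" x] assms by simp

lemma convex_hull_inner_eq:
  assumes "\<And>v. v \<in> S \<Longrightarrow> w \<bullet> v = c" "x \<in> convex hull S"
  shows "w \<bullet> x = c"
proof -
  have "convex hull S \<subseteq> {x. w \<bullet> x = c}"
    using assms(1) by (intro hull_minimal) (auto simp: convex_hyperplane)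
  with assms(2) show ?thesis by blast
qed

text \<open>Every face of the hull of a finite set is the hull of some of its points, and these must
  lie in the hyperplane that cuts out the face.\<close>

lemma convex_hull_Int_supporting_hyperplane:
  fixes S :: "'a::euclidean_space set"
  assumes "finite S" "\<And>v. v \<in> S \<Longrightarrow> w \<bullet> v \<le> c"
  shows "convex hull S \<inter> {x. w \<bullet> x = c} = convex hull (S \<inter> {x. w \<bullet> x = c})" (is "?F = ?G")
    and "convex hull (S \<inter> {x. w \<bullet> x = c}) face_of convex hull S"
proof -
  have face: "?F face_of convex hull S"
    using convex_hull_inner_le[OF assms(2)]
    by (intro face_of_Int_supporting_hyperplane_le) auto
  then obtain T where T: "T \<subseteq> S" "?F = convex hull T"
    using face_of_convex_hull_subset[OF finite_imp_compact[OF assms(1)]] by metis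
  have "T \<subseteq> ?F"
    unfolding T(2) by (rule hull_subset)
  with T have "?F \<subseteq> ?G"
    by (metis hull_mono le_inf_iff)
  moreover have "?G \<subseteq> ?F"
    by (intro hull_minimal convex_Int convex_convex_hull convex_hyperplane)
       (auto simp: hull_inc)
  ultimately show eq: "?F = ?G" by blast
  show "?G face_of convex hull S" using face eq by simp
qed

section \<open>Polygonal paths\<close>

lemma pathstart_polygonal_path: "vs \<noteq> [] \<Longrightarrow> pathstart (polygonal_path vs) = hd vs"
  by (induction vs rule: polygonal_path.induct) auto

lemma pathfinish_polygonal_path: "vs \<noteq> [] \<Longrightarrow> pathfinish (polygonal_path vs) = last vs"
  by (induction vs rule: polygonal_path.induct) auto

lemma path_image_polygonal_path:
  "2 \<le> length vs \<Longrightarrow>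
    path_image (polygonal_path vs) = (\<Union>i<length vs - 1. closed_segment (vs ! i) (vs ! Suc i))"
proof (induction vs rule: polygonal_path.induct)
  case (4 a b c vs)
  have "path_image (polygonal_path (a # b # c # vs)) =
      closed_segment a b \<union> path_image (polygonal_path (b # c # vs))"
    by (simp add: path_image_join pathstart_polygonal_path)
  also have "\<dots> = closed_segment a b \<union>
      (\<Union>i<length (c # vs). closed_segment ((b # c # vs) ! i) ((b # c # vs) ! Suc i))"
    using 4 by simp
  also have "\<dots> = (\<Union>i<Suc (length (c # vs)).
      closed_segment ((a # b # c # vs) ! i) ((a # b # c # vs) ! Suc i))"
    unfolding lessThan_Suc_eq_insert_0 by auto
  finally show ?case by simp
qed auto

text \<open>By induction: the separation hypotheses pass to the tail with indices shifted by one,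
  and the first segment meets the tail only where the two are joined.\<close>

lemma arc_polygonal_path:
  assumes "2 \<le> length vs"
    and "\<And>i. Suc i < length vs \<Longrightarrow> vs ! i \<noteq> vs ! Suc i"
    and "\<And>i j. i < j \<Longrightarrow> Suc j < length vs \<Longrightarrow>
      closed_segment (vs ! i) (vs ! Suc i) \<inter> closed_segment (vs ! j) (vs ! Suc j)
        \<subseteq> (if j = Suc i then {vs ! j} else {})"
  shows "arc (polygonal_path vs)"
  using assms
proof (induction vs rule: polygonal_path.induct)
  case (3 a b)
  then show ?case using "3.prems"(2)[of 0] by simp
next
  case (4 a b c vs)
  let ?ws = "b # c # vs"
  have "arc (polygonal_path ?ws)"
  proof (rule "4.IH")
    show "?ws ! i \<noteq> ?ws ! Suc i" if "Suc i < length ?ws" for i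
      using "4.prems"(2)[of "Suc i"] that by simp
    show "closed_segment (?ws ! i) (?ws ! Suc i) \<inter> closed_segment (?ws ! j) (?ws ! Suc j)
        \<subseteq> (if j = Suc i then {?ws ! j} else {})" if "i < j" "Suc j < length ?ws" for i j
      using "4.prems"(3)[of "Suc i" "Suc j"] that by (auto split: if_splits)
  qed simp
  moreover have "closed_segment a b \<inter> path_image (polygonal_path ?ws) \<subseteq> {b}"
  proof
    fix x assume x: "x \<in> closed_segment a b \<inter> path_image (polygonal_path ?ws)"
    then obtain i where i: "i < length ?ws - 1" "x \<in> closed_segment (?ws ! i) (?ws ! Suc i)"
      by (auto simp: path_image_polygonal_path)
    with x "4.prems"(3)[of 0 "Suc i"] show "x \<in> {b}"
      by (auto split: if_splits)
  qed
  ultimately show ?case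
    using "4.prems"(2)[of 0] by (auto intro!: arc_join simp: pathstart_polygonal_path)
qed auto

section \<open>Convex polygons\<close>

text \<open>The functional of index \<open>i\<close> supports the hull of the corners exactly along the edge from
  corner \<open>i\<close> to its successor.\<close>

locale convex_polygon =
  fixes vs :: "'a::euclidean_space list" and w :: "nat \<Rightarrow> 'a"
  assumes length_ge: "3 \<le> length vs"
    and aff_dim_le: "aff_dim (set vs) \<le> 2"
    and supp_eq: "\<And>i. i < length vs \<Longrightarrow> w i \<bullet> vs ! (Suc i mod length vs) = w i \<bullet> vs ! i"
    and supp_less: "\<And>i k. \<lbrakk>i < length vs; k < length vs; k \<noteq> i; k \<noteq> Suc i mod length vs\<rbrakk>
      \<Longrightarrow> w i \<bullet> vs ! k < w i \<bullet> vs ! i"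
begin

section \<open>Cyclic indexing of the corners\<close>

abbreviation "n \<equiv> length vs"
definition nx :: "nat \<Rightarrow> nat" where "nx i = Suc i mod n"
abbreviation "edge i \<equiv> closed_segment (vs ! i) (vs ! nx i)"
abbreviation "K \<equiv> convex hull set vs"

lemma nx_less: "nx i < n"
  unfolding nx_def using length_ge by (intro mod_less_divisor) linarith

lemma nx_eq: "i < n \<Longrightarrow> nx i = (if Suc i = n then 0 else Suc i)"
  by (auto simp: nx_def)

lemma nx_neq: "i < n \<Longrightarrow> nx i \<noteq> i" "i < n \<Longrightarrow> nx (nx i) \<noteq> i"
  using length_ge nx_eq[of i] nx_eq[OF nx_less, of i] by (simp_all split: if_splits)

lemma nx_surj:
  assumes "i < n"
  obtains j where "j < n" "nx j = i"
proof (cases i)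
  case 0
  have "Suc (n - 1) = n" using length_ge by linarith
  with 0 length_ge show ?thesis by (intro that[of "n - 1"]) (auto simp: nx_def simp del: Suc_pred)
next
  case (Suc m)
  with that[of m] assms show ?thesis by (simp add: nx_def)
qed

lemma nx_inj: "i < n \<Longrightarrow> j < n \<Longrightarrow> nx i = nx j \<Longrightarrow> i = j"
  by (auto simp: nx_eq split: if_splits)

lemma supp_eq_nx: "i < n \<Longrightarrow> w i \<bullet> vs ! nx i = w i \<bullet> vs ! i"
  and supp_less_nx: "\<lbrakk>i < n; k < n; k \<noteq> i; k \<noteq> nx i\<rbrakk> \<Longrightarrow> w i \<bullet> vs ! k < w i \<bullet> vs ! i"
  using supp_eq supp_less by (simp_all add: nx_def)

lemma supp_le: "i < n \<Longrightarrow> k < n \<Longrightarrow> w i \<bullet> vs ! k \<le> w i \<bullet> vs ! i"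
  using supp_less_nx[of i k] by (cases "k = i \<or> k = nx i") (auto simp: supp_eq_nx)

lemma supp_eq_iff: "i < n \<Longrightarrow> k < n \<Longrightarrow> w i \<bullet> vs ! k = w i \<bullet> vs ! i \<longleftrightarrow> k = i \<or> k = nx i"
  using supp_less_nx[of i k] by (cases "k = i \<or> k = nx i") (auto simp: supp_eq_nx)

text \<open>Equal corners with different indices would each maximize the functional of the other,
  hence be successors of each other, which a cycle of length at least three excludes.\<close>

lemma nth_inj:
  assumes "i < n" "j < n" "vs ! i = vs ! j"
  shows "i = j"
proof (rule ccontr)
  assume "i \<noteq> j"
  with assms have "j = nx i" "i = nx j"
    using supp_eq_iff[of i j] supp_eq_iff[of j i] by auto
  with assms(1) nx_neq(2) show False by metis
qed

lemma distinct: "distinct vs"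
  using nth_inj by (auto simp: distinct_conv_nth)

section \<open>Edges as faces of the hull\<close>

lemma edge_eq_Int:
  assumes "i < n"
  shows "K \<inter> {x. w i \<bullet> x = w i \<bullet> vs ! i} = edge i" "edge i face_of K"
proof -
  have *: "set vs \<inter> {x. w i \<bullet> x = w i \<bullet> vs ! i} = {vs ! i, vs ! nx i}"
    using supp_eq_iff[OF assms] assms nx_less[of i] by (auto simp: in_set_conv_nth supp_eq)
  have "w i \<bullet> v \<le> w i \<bullet> vs ! i" if "v \<in> set vs" for v
    using that supp_le[OF assms] by (auto simp: in_set_conv_nth)
  from convex_hull_Int_supporting_hyperplane[of "set vs", OF _ this, unfolded *]
  show "K \<inter> {x. w i \<bullet> x = w i \<bullet> vs ! i} = edge i" "edge i face_of K"
    by (simp_all add: segment_convex_hull)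
qed

text \<open>At most one end of \<open>edge j\<close> maximizes \<open>w i\<close> over the corners,
  so the hyperplane supporting \<open>edge i\<close> cuts \<open>edge j\<close> in that end or not
  at all.\<close>

lemma edge_Int_edge:
  assumes "i < n" "j < n" "i \<noteq> j"
  shows "edge i \<inter> edge j \<subseteq> (if j = nx i then {vs ! j} else if i = nx j then {vs ! i} else {})"
proof
  fix x assume x: "x \<in> edge i \<inter> edge j"
  let ?T = "{vs ! j, vs ! nx j} \<inter> {x. w i \<bullet> x = w i \<bullet> vs ! i}"
  have "x \<in> convex hull {vs ! j, vs ! nx j} \<inter> {x. w i \<bullet> x = w i \<bullet> vs ! i}"
    using x edge_eq_Int(1)[OF assms(1)] by (auto simp: segment_convex_hull)
  also have "\<dots> = convex hull ?T"
    by (rule convex_hull_Int_supporting_hyperplane) (use assms supp_le nx_less in auto)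
  also have "?T \<subseteq> (if j = nx i then {vs ! j} else if i = nx j then {vs ! i} else {})"
    using assms nx_neq[OF assms(1)] nx_neq[OF assms(2)] nx_inj[of i j] nx_less[of j]
    by (auto simp: supp_eq_iff)
  then have "convex hull ?T \<subseteq> convex hull (if j = nx i then {vs ! j} else if i = nx j then {vs ! i} else {})"
    by (rule hull_mono)
  also have "\<dots> = (if j = nx i then {vs ! j} else if i = nx j then {vs ! i} else {})"
    by simp
  finally show "x \<in> (if j = nx i then {vs ! j} else if i = nx j then {vs ! i} else {})" .
qed

section \<open>The boundary path is simple\<close>

lemma nth_closing: "k \<le> n \<Longrightarrow> (vs @ [hd vs]) ! k = vs ! (k mod n)"
  using length_ge by (cases "k = n") (auto simp: nth_append hd_conv_nth simp flip: length_greater_0_conv)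

lemma path_image_boundary: "path_image (boundary_path vs) = (\<Union>i<n. edge i)"
proof -
  have "path_image (boundary_path vs) =
      (\<Union>i<n. closed_segment ((vs @ [hd vs]) ! i) ((vs @ [hd vs]) ! Suc i))"
    unfolding boundary_path_def using length_ge by (subst path_image_polygonal_path) auto
  also have "\<dots> = (\<Union>i<n. edge i)"
    by (intro SUP_cong) (auto simp: nth_closing nx_def simp del: nth_append_length)
  finally show ?thesis .
qed

text \<open>The first edge and the arc formed by all other edges share just their two ends, so
  joining them gives a simple loop.\<close>

lemma simple_path_boundary: "simple_path (boundary_path vs)"
proof -
  obtain a b c r where vs: "vs = a # b # c # r"
    using length_ge by (metis One_nat_def Suc_le_length_iff numeral_3_eq_3)
  \<comment> \<open>From the second corner around and back to \<open>a\<close>: segment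
    \<open>i\<close> of \<open>ws\<close> is \<open>edge (Suc i)\<close>.\<close>
  define ws where "ws = b # c # r @ [a]"
  have len: "length ws = n" by (simp add: ws_def vs)
  have nx0: "nx 0 = Suc 0" using length_ge by (simp add: nx_def)
  have v01: "vs ! 0 = a" "vs ! Suc 0 = b" by (simp_all add: vs)
  have ws_nth: "ws ! i = vs ! nx i" if "i < n" for i
    using that nth_closing[of "Suc i"] by (simp add: nx_def) (simp add: ws_def vs)
  have edges: "closed_segment (ws ! i) (ws ! Suc i) = edge (Suc i)" if "Suc i < n" for i
    using that by (simp add: ws_nth nx_eq)
  have "arc (polygonal_path ws)"
  proof (rule arc_polygonal_path)
    show "2 \<le> length ws" by (simp add: ws_def)
    show "ws ! i \<noteq> ws ! Suc i" if "Suc i < length ws" for i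
      using that nx_neq(1)[of "Suc i"] nth_inj[of "Suc i" "nx (Suc i)"] nx_less
      by (simp add: len ws_nth nx_eq[of i]) metis
    show "closed_segment (ws ! i) (ws ! Suc i) \<inter> closed_segment (ws ! j) (ws ! Suc j)
        \<subseteq> (if j = Suc i then {ws ! j} else {})" if "i < j" "Suc j < length ws" for i j
      using edge_Int_edge[of "Suc i" "Suc j"] that
      by (auto simp: len edges nx_eq ws_nth split: if_splits)
  qed
  moreover have "a \<noteq> b"
    using distinct by (simp add: vs)
  moreover have "closed_segment a b \<inter> path_image (polygonal_path ws) \<subseteq> {a, b}"
  proof
    fix x assume x: "x \<in> closed_segment a b \<inter> path_image (polygonal_path ws)"
    then obtain i where i: "Suc i < n" "x \<in> edge (Suc i)"
      using length_ge edges by (auto simp: path_image_polygonal_path len less_diff_conv)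
    moreover have "x \<in> edge 0" using x nx0 v01 by simp
    ultimately have "x \<in> (if Suc i = nx 0 then {vs ! Suc i} else
        if 0 = nx (Suc i) then {vs ! 0} else {})"
      using edge_Int_edge[of 0 "Suc i"] length_ge by fastforce
    then show "x \<in> {a, b}"
      using nx0 v01 by (auto split: if_splits)
  qed
  moreover have "boundary_path vs = linepath a b +++ polygonal_path ws"
    by (simp add: boundary_path_def vs ws_def)
  ultimately show ?thesis
    by (auto intro!: simple_path_join_loop
        simp: ws_def pathstart_polygonal_path pathfinish_polygonal_path)
qed

section \<open>Extreme corners and the plane they span\<close>

lemma extreme_corner:
  assumes "v \<in> set vs"
  shows "v extreme_point_of K"
proof -
  obtain i where i: "i < n" "v = vs ! i"
    using assms by (auto simp: in_set_conv_nth)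
  have "v extreme_point_of edge i"
    by (simp add: i extreme_point_of_segment)
  with extreme_point_of_face[OF edge_eq_Int(2)[OF i(1)]] show ?thesis by blast
qed

lemma corner_notin_open_segment:
  "\<lbrakk>a \<in> set vs; b \<in> set vs; c \<in> set vs\<rbrakk> \<Longrightarrow> b \<notin> open_segment a c"
  using extreme_corner[of b] by (auto simp: extreme_point_of_def hull_inc)

text \<open>Of three distinct collinear points one lies strictly between the others, which an
  extreme point cannot.\<close>

lemma not_collinear:
  assumes "a \<in> set vs" "b \<in> set vs" "c \<in> set vs" "a \<noteq> b" "b \<noteq> c" "a \<noteq> c"
  shows "\<not> collinear {a, b, c}"
  using assms corner_notin_open_segment
  unfolding collinear_between_cases between_mem_segment open_segment_def by blast

lemma aff_dim_eq: "aff_dim (set vs) = 2"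
proof (rule ccontr)
  assume "aff_dim (set vs) \<noteq> 2"
  with aff_dim_le have "collinear (set vs)"
    by (simp add: collinear_aff_dim)
  moreover have lt: "0 < n" "1 < n" "2 < n"
    using length_ge by linarith+
  then have "{vs ! 0, vs ! 1, vs ! 2} \<subseteq> set vs" by simp
  ultimately have "collinear {vs ! 0, vs ! 1, vs ! 2}"
    by (metis collinear_subset)
  moreover have "vs ! 0 \<noteq> vs ! 1" "vs ! 1 \<noteq> vs ! 2" "vs ! 0 \<noteq> vs ! 2"
    using lt by (simp_all add: nth_eq_iff_index_eq distinct)
  ultimately show False
    using not_collinear lt by (meson nth_mem)
qed

text \<open>A noncollinear triple already has the dimension of the plane. This gives coordinates
  based at a corner.\<close>

lemma affine_hull_corner:
  assumes p: "p < n"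
  shows "affine hull {vs ! p, vs ! nx p, vs ! nx (nx p)} = affine hull set vs"
proof -
  let ?A = "{vs ! p, vs ! nx p, vs ! nx (nx p)}"
  have ne: "vs ! p \<noteq> vs ! nx p" "vs ! nx p \<noteq> vs ! nx (nx p)" "vs ! p \<noteq> vs ! nx (nx p)"
    using nth_inj p nx_less nx_neq by metis+
  have sub: "?A \<subseteq> set vs" using p nx_less by simp
  have "\<not> collinear ?A"
    using sub ne by (intro not_collinear) auto
  then have "aff_dim ?A \<ge> 2" by (simp add: collinear_aff_dim)
  with aff_dim_subset[OF sub] aff_dim_eq have "aff_dim ?A = aff_dim (set vs)" by simp
  then show ?thesis using sub by (metis aff_dim_eq_full_gen)
qed

text \<open>A corner is spanned by its two edge directions, on both of which a supporting functional
  at that corner is nonpositive. So a third corner in the supporting line would make the functional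
  constant.\<close>

lemma supporting_corner:
  assumes p: "p < n" and b: "b < n" and ne: "b \<noteq> p" "b \<noteq> nx p" "b \<noteq> nx (nx p)"
    and le: "\<And>v. v \<in> set vs \<Longrightarrow> g \<bullet> v \<le> c"
    and c: "g \<bullet> vs ! nx p = c" "g \<bullet> vs ! b = c"
    and v: "v \<in> set vs"
  shows "g \<bullet> v = c"
proof -
  define a where "a = nx p"
  have a: "a < n" "a \<noteq> p" "nx a \<noteq> p" "nx a \<noteq> a" "nx a < n"
    using p nx_less nx_neq by (auto simp: a_def)
  let ?A = "{vs ! p, vs ! a, vs ! nx a}"
  have aff: "affine hull ?A = affine hull set vs"
    using affine_hull_corner[OF p] by (simp add: a_def)
  have comb: "\<exists>r s. x = vs ! a + r *\<^sub>R (vs ! p - vs ! a) + s *\<^sub>R (vs ! nx a - vs ! a)"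
    if "x \<in> set vs" for x
  proof -
    have "x \<in> affine hull ?A" using that aff by (simp add: hull_inc)
    then obtain q r s where "q + r + s = 1" "x = q *\<^sub>R vs ! p + r *\<^sub>R vs ! a + s *\<^sub>R vs ! nx a"
      by (auto simp: affine_hull_3)
    moreover from this(1) have "r = 1 - q - s" by simp
    ultimately have "x = (1 - q - s) *\<^sub>R vs ! a + q *\<^sub>R vs ! p + s *\<^sub>R vs ! nx a"
      by (simp add: add.commute)
    then have "x = vs ! a + q *\<^sub>R (vs ! p - vs ! a) + s *\<^sub>R (vs ! nx a - vs ! a)"
      by (simp add: algebra_simps)
    then show ?thesis by blast
  qed
  obtain r s where rs: "vs ! b = vs ! a + r *\<^sub>R (vs ! p - vs ! a) + s *\<^sub>R (vs ! nx a - vs ! a)"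
    using comb b by (meson nth_mem)
  \<comment> \<open>Relative to its maximum, \<open>w p\<close> vanishes at corners \<open>p\<close>
    and \<open>a\<close> and is negative at \<open>nx a\<close> and \<open>b\<close>. This forces
    \<open>s > 0\<close>, and \<open>w a\<close> gives \<open>r > 0\<close> in the same way.\<close>
  have "w p \<bullet> vs ! b < w p \<bullet> vs ! p" "w p \<bullet> vs ! nx a < w p \<bullet> vs ! p" "w p \<bullet> vs ! a = w p \<bullet> vs ! p"
    using supp_less_nx[OF p] supp_eq_nx[OF p] b ne a by (auto simp: a_def)
  then have "s * (w p \<bullet> vs ! nx a - w p \<bullet> vs ! p) < 0" "w p \<bullet> vs ! nx a - w p \<bullet> vs ! p < 0"
    unfolding rs by (simp_all add: inner_simps)
  then have s: "s > 0" by (simp add: mult_less_0_iff)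
  have "w a \<bullet> vs ! b < w a \<bullet> vs ! a" "w a \<bullet> vs ! p < w a \<bullet> vs ! a" "w a \<bullet> vs ! nx a = w a \<bullet> vs ! a"
    using supp_less_nx[OF a(1)] supp_eq_nx[OF a(1)] b p ne a by (auto simp: a_def)
  then have "r * (w a \<bullet> vs ! p - w a \<bullet> vs ! a) < 0" "w a \<bullet> vs ! p - w a \<bullet> vs ! a < 0"
    unfolding rs by (simp_all add: inner_simps)
  then have r: "r > 0" by (simp add: mult_less_0_iff)
  have ga: "g \<bullet> vs ! a = c" using c by (simp add: a_def)
  have gp: "g \<bullet> vs ! p \<le> c" "g \<bullet> vs ! nx a \<le> c" using le a p by auto
  \<comment> \<open>Two nonpositive terms with sum zero both vanish.\<close>
  have "r * (g \<bullet> vs ! p - c) + s * (g \<bullet> vs ! nx a - c) = 0"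
    using c(2) unfolding rs by (simp add: inner_simps ga)
  moreover have "r * (g \<bullet> vs ! p - c) \<le> 0" "s * (g \<bullet> vs ! nx a - c) \<le> 0"
    using r s gp by (auto simp: mult_le_0_iff)
  ultimately have "r * (g \<bullet> vs ! p - c) = 0" "s * (g \<bullet> vs ! nx a - c) = 0" by linarith+
  with r s have "g \<bullet> vs ! p = c" "g \<bullet> vs ! nx a = c" by auto
  then show ?thesis
    using comb[OF v] ga by (auto simp: inner_simps)
qed

text \<open>Edges are proper faces. Conversely, a frontier point lies in the hull of the corners on
  a supporting line, and these turn out to be ends of a single edge.\<close>

lemma rel_frontier_hull: "rel_frontier K = (\<Union>i<n. edge i)"
proof (intro equalityI subsetI)
  fix x assume "x \<in> (\<Union>i<n. edge i)"
  then obtain i where i: "i < n" "x \<in> edge i" by auto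
  have "edge i \<noteq> K"
  proof
    assume "edge i = K"
    then have "aff_dim (set vs) = aff_dim {vs ! i, vs ! nx i}"
      by (metis aff_dim_convex_hull segment_convex_hull)
    then show False using aff_dim_2[of "vs ! i" "vs ! nx i"] aff_dim_eq by (auto split: if_splits)
  qed
  with edge_eq_Int(2)[OF i(1)] i(2) show "x \<in> rel_frontier K"
    using face_of_subset_rel_frontier by blast
next
  fix x assume "x \<in> rel_frontier K"
  then have x: "x \<in> K" "x \<notin> rel_interior K"
    by (auto simp: rel_frontier_def finite_imp_compact_convex_hull compact_imp_closed)
  then obtain g' where g': "\<And>y. y \<in> K \<Longrightarrow> g' \<bullet> x \<le> g' \<bullet> y"
      "\<And>y. y \<in> rel_interior K \<Longrightarrow> g' \<bullet> x < g' \<bullet> y"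
    using supporting_hyperplane_rel_boundary[OF convex_convex_hull] by metis
  \<comment> \<open>The sign change turns the minimum at \<open>x\<close> into a maximum.\<close>
  define g c where "g = - g'" and "c = g \<bullet> x"
  have le: "g \<bullet> v \<le> c" if "v \<in> set vs" for v
    using g'(1)[of v] that by (simp add: g_def c_def hull_inc)
  have nconst: "\<exists>v \<in> set vs. g \<bullet> v \<noteq> c"
  proof (rule ccontr)
    assume *: "\<not> ?thesis"
    have "rel_interior K \<noteq> {}"
      using length_ge by (auto simp: rel_interior_eq_empty)
    then obtain y where y: "y \<in> rel_interior K" by blast
    then have "y \<in> K" using rel_interior_subset by blast
    then have "g \<bullet> y = c" using convex_hull_inner_eq[of "set vs" g c y] * by blast
    with g'(2)[OF y] show False by (simp add: g_def c_def)
  qed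
  let ?T = "set vs \<inter> {y. g \<bullet> y = c}"
  have xT: "x \<in> convex hull ?T"
    using convex_hull_Int_supporting_hyperplane(1)[of "set vs" g c] le x by (auto simp: c_def)
  then have "?T \<noteq> {}" by (metis convex_hull_empty empty_iff)
  then obtain v where "v \<in> set vs" "g \<bullet> v = c" by blast
  then obtain a where a: "a < n" "g \<bullet> vs ! a = c" by (metis in_set_conv_nth)
  obtain p where p: "p < n" "nx p = a" using nx_surj[OF a(1)] by metis
  \<comment> \<open>By \<open>supporting_corner\<close>, any further corner on the line would make
    \<open>g\<close> constant, against \<open>nconst\<close>.\<close>
  have three: "b = p \<or> b = a \<or> b = nx a" if "b < n" "g \<bullet> vs ! b = c" for b
    using supporting_corner[OF p(1) that(1) _ _ _ le _ that(2)] p(2) a(2) nconst by blast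
  \<comment> \<open>Corner \<open>a\<close> and both its neighbours span the plane, so they cannot
    all lie on the line.\<close>
  have "\<not> (g \<bullet> vs ! p = c \<and> g \<bullet> vs ! nx a = c)"
  proof
    assume *: "g \<bullet> vs ! p = c \<and> g \<bullet> vs ! nx a = c"
    have "g \<bullet> v = c" if "v \<in> set vs" for v
    proof -
      have "v \<in> affine hull {vs ! p, vs ! a, vs ! nx a}"
        using affine_hull_corner[OF p(1)] that by (simp add: p(2) hull_inc)
      moreover have "affine hull {vs ! p, vs ! a, vs ! nx a} \<subseteq> {y. g \<bullet> y = c}"
        using * a by (intro hull_minimal affine_hyperplane) auto
      ultimately show ?thesis by blast
    qed
    with nconst show False by blast
  qed
  then have "?T \<subseteq> {vs ! a, vs ! nx a} \<or> ?T \<subseteq> {vs ! p, vs ! nx p}"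
  proof -
    have "?T \<subseteq> {vs ! p, vs ! a, vs ! nx a}"
    proof
      fix v assume v: "v \<in> ?T"
      then obtain b where "b < n" "vs ! b = v" by (meson IntD1 in_set_conv_nth)
      with three[of b] v show "v \<in> {vs ! p, vs ! a, vs ! nx a}" by auto
    qed
    with \<open>\<not> (g \<bullet> vs ! p = c \<and> g \<bullet> vs ! nx a = c)\<close> show ?thesis
      unfolding p(2) by blast
  qed
  then have "x \<in> edge a \<or> x \<in> edge p"
    unfolding segment_convex_hull using xT hull_mono by blast
  with a p show "x \<in> (\<Union>i<n. edge i)" by auto
qed

section \<open>The enclosed region is the hull\<close>

lemma path_image_eq_rel_frontier: "path_image (boundary_path vs) = rel_frontier K"
  by (simp add: path_image_boundary rel_frontier_hull)

text \<open>In the plane without the frontier of \<open>K\<close>, a point outside \<open>K\<close>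
  starts a ray that avoids \<open>K\<close>, so its component is unbounded; the component of a
  relative interior point stays inside \<open>K\<close>.\<close>

lemma region_eq: "region vs = K"
proof -
  have P: "affine hull set vs = affine hull K" by simp
  have clK: "closed K" by (simp add: finite_imp_compact_convex_hull compact_imp_closed)
  have bK: "bounded K" by (simp add: finite_imp_bounded_convex_hull)
  have fr: "rel_frontier K = K - rel_interior K"
    using clK by (simp add: rel_frontier_def)
  have subP: "K \<subseteq> affine hull K" by (rule hull_subset)
  have in_K: "x \<in> K" if "x \<in> affine hull K - rel_frontier K"
      "bounded (connected_component_set (affine hull K - rel_frontier K) x)" for x
  proof (rule ccontr)
    assume "x \<notin> K"
    obtain a where a: "a \<in> K" using length_ge by (metis hull_inc length_0_conv not_numeral_le_zero list.set_intros(1) neq_Nil_conv)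
    \<comment> \<open>The ray points away from \<open>a\<close>. If it met \<open>K\<close>, then
      \<open>x\<close> would lie between \<open>a\<close> and that meeting point, hence in
      \<open>K\<close>.\<close>
    let ?ray = "(\<lambda>t. x + t *\<^sub>R (x - a)) ` {0..}"
    have "?ray \<inter> K = {}"
    proof (safe, simp)
      fix t :: real assume t: "0 \<le> t" "x + t *\<^sub>R (x - a) \<in> K"
      have "x = (t / (1 + t)) *\<^sub>R a + (1 / (1 + t)) *\<^sub>R (x + t *\<^sub>R (x - a))"
      proof -
        have "(1 + t) *\<^sub>R x = t *\<^sub>R a + (x + t *\<^sub>R (x - a))" by (simp add: algebra_simps)
        then have "(1 / (1 + t)) *\<^sub>R ((1 + t) *\<^sub>R x) = (1 / (1 + t)) *\<^sub>R (t *\<^sub>R a + (x + t *\<^sub>R (x - a)))" by simp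
        with t(1) show ?thesis by (simp add: scaleR_add_right)
      qed
      also have "\<dots> \<in> K"
        using t a by (intro convexD[OF convex_convex_hull]) (auto simp: field_simps)
      finally show False using \<open>x \<notin> K\<close> by simp
    qed
    moreover have "?ray \<subseteq> affine hull K"
    proof safe
      fix t :: real
      have "(1 + t) *\<^sub>R x + (- t) *\<^sub>R a \<in> affine hull K"
        using that(1) a subP by (intro mem_affine[OF affine_affine_hull]) auto
      then show "x + t *\<^sub>R (x - a) \<in> affine hull K" by (simp add: algebra_simps)
    qed
    moreover have "Topological_Spaces.connected ?ray"
      by (intro connected_continuous_image continuous_intros) auto
    moreover have "x \<in> ?ray" by (auto intro!: image_eqI[of _ _ 0])
    ultimately have "?ray \<subseteq> connected_component_set (affine hull K - rel_frontier K) x"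
      using fr by (intro connected_component_maximal) auto
    with that(2) have "bounded ?ray" using bounded_subset by blast
    then obtain B where B: "\<And>t. t \<ge> 0 \<Longrightarrow> norm (x + t *\<^sub>R (x - a)) \<le> B"
      by (auto simp: bounded_iff)
    \<comment> \<open>Chosen so that the triangle inequality puts the ray point at \<open>t\<close>
      beyond norm \<open>B\<close>.\<close>
    define t where "t = (B + norm x + 1) / norm (x - a)"
    have xa: "norm (x - a) > 0" using a \<open>x \<notin> K\<close> by auto
    have "B \<ge> 0" using B[of 0] norm_ge_zero order_trans by blast
    then have "t \<ge> 0" by (simp add: t_def)
    have "norm (t *\<^sub>R (x - a)) = B + norm x + 1"
      using xa \<open>B \<ge> 0\<close> by (simp add: t_def)
    moreover have "norm (t *\<^sub>R (x - a)) \<le> norm (x + t *\<^sub>R (x - a)) + norm x"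
      by (metis add_diff_cancel_left' norm_triangle_ineq4)
    ultimately show False using B[OF \<open>t \<ge> 0\<close>] by linarith
  qed
  have int: "bounded (connected_component_set (affine hull K - rel_frontier K) x)"
    if x: "x \<in> rel_interior K" for x
  proof -
    let ?Q = "connected_component_set (affine hull K - rel_frontier K) x"
    have sub: "?Q \<subseteq> affine hull K - rel_frontier K" by (rule connected_component_subset)
    obtain U where U: "open U" "rel_interior K = affine hull K \<inter> U"
      using openin_rel_interior[of K] by (auto simp: openin_open)
    \<comment> \<open>Off the frontier, \<open>K\<close> agrees with its relative interior, so it
      cuts the component in a set that is both open and closed.\<close>
    have "?Q \<inter> K = ?Q \<inter> U"
      using sub U(2) fr rel_interior_subset[of K] by blast
    then have "openin (top_of_set ?Q) (?Q \<inter> K)" "closedin (top_of_set ?Q) (?Q \<inter> K)"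
      using U(1) clK by (auto simp: openin_open closedin_closed)
    then have "?Q \<inter> K = {} \<or> ?Q \<inter> K = ?Q"
      using connected_connected_component[of "affine hull K - rel_frontier K" x]
      unfolding connected_clopen by blast
    moreover have "x \<in> ?Q \<inter> K"
      using x fr subP rel_interior_subset[of K] by (auto simp: connected_component_refl_eq)
    ultimately have "?Q \<subseteq> K" by blast
    with bK show ?thesis by (rule bounded_subset)
  qed
  show ?thesis
    unfolding region_def Let_def path_image_eq_rel_frontier P
    using in_K int fr subP rel_interior_subset[of K] by auto
qed

section \<open>Polygon predicates and sides\<close>

lemma is_polygon: "is_polygon vs"
  unfolding is_polygon_def using length_ge simple_path_boundary aff_dim_eq by simp

lemma strictly_convex_polygon: "strictly_convex_polygon vs"
  unfolding strictly_convex_polygon_def corners_def region_eq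
  using is_polygon extreme_corner by simp

lemma sides_eq: "sides vs = edge ` {..<n}"
  unfolding sides_def nx_def by auto

lemma side_subset_rel_frontier: "e \<in> sides vs \<Longrightarrow> e \<subseteq> rel_frontier (region vs)"
  unfolding sides_eq region_eq rel_frontier_hull by blast

lemma side_subset_region: "e \<in> sides vs \<Longrightarrow> e \<subseteq> region vs"
  using edge_eq_Int(1) unfolding sides_eq region_eq by blast

lemma side_nonempty: "e \<in> sides vs \<Longrightarrow> e \<noteq> {}"
  unfolding sides_eq by auto

lemma rel_interior_Int_side: "e \<in> sides vs \<Longrightarrow> rel_interior (region vs) \<inter> e = {}"
  using side_subset_rel_frontier by (auto simp: rel_frontier_def)

lemma rel_interior_region_nonempty: "rel_interior (region vs) \<noteq> {}"
  using length_ge by (auto simp: region_eq rel_interior_eq_empty)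

text \<open>A side misses the relative interior, which is nonempty. This later shows that polygons
  of different classes are distinct.\<close>

lemma region_notin_sides: "region vs \<notin> sides vs"
  using rel_interior_Int_side[of "region vs"] rel_interior_region_nonempty rel_interior_subset
  by blast

end

section \<open>Surfaces with a complete bipartite adjacency graph\<close>

text \<open>Among three polygons two belong to one class and are disjoint, so the condition on
  triples is vacuous. Disjointness is symmetric, so increasing index pairs suffice.\<close>

lemma complete_bipartite_surface:
  fixes A B :: "nat \<Rightarrow> (real^3) list"
  assumes A: "\<And>i. i < m \<Longrightarrow> \<exists>w. convex_polygon (A i) w"
    and B: "\<And>j. j < n \<Longrightarrow> \<exists>w. convex_polygon (B j) w"
    and AA: "\<And>i i'. i < i' \<Longrightarrow> i' < m \<Longrightarrow> region (A i) \<inter> region (A i') = {}"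
    and BB: "\<And>j j'. j < j' \<Longrightarrow> j' < n \<Longrightarrow> region (B j) \<inter> region (B j') = {}"
    and AB: "\<And>i j. i < m \<Longrightarrow> j < n \<Longrightarrow> region (A i) \<inter> region (B j) \<in> sides (A i) \<inter> sides (B j)"
  defines "\<S> \<equiv> A ` {..<m} \<union> B ` {..<n}"
  shows "convex_polyhedral_surface \<S>"
    and "digraph_iso (with_proj (adjacency_graph \<S>)) (with_proj (complete_bipartite_graph m n))"
proof -
  define V :: "(nat + nat) set" where "V = Inl ` {..<m} \<union> Inr ` {..<n}"
  \<comment> \<open>The disjoint sum indexes both classes at once; \<open>E\<close> says that two
    indices are of different classes.\<close>
  define E :: "(nat + nat) \<Rightarrow> (nat + nat) \<Rightarrow> bool" where "E x y \<longleftrightarrow> isl x \<noteq> isl y" for x y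
  define F where "F = case_sum A B"
  have \<S>: "\<S> = F ` V"
    unfolding \<S>_def V_def F_def by (auto simp: image_Un image_image)
  have poly: "\<exists>w. convex_polygon (F x) w" if "x \<in> V" for x
    using that A B by (auto simp: V_def F_def)
  have disj: "region (F x) \<inter> region (F y) = {}" if "x \<in> V" "y \<in> V" "x \<noteq> y" "\<not> E x y" for x y
    using that AA BB unfolding V_def F_def E_def
    by (auto simp: Int_commute) (metis Int_commute disjoint_iff linorder_neqE_nat)+
  have meet: "region (F x) \<inter> region (F y) \<in> sides (F x) \<inter> sides (F y)"
    if "x \<in> V" "y \<in> V" "E x y" for x y
    using that AB unfolding V_def F_def E_def by (auto simp: Int_commute)
  have sides_ne: "sides (F x) \<inter> sides (F y) \<noteq> {} \<longleftrightarrow> E x y"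
    if "x \<in> V" "y \<in> V" "x \<noteq> y" for x y
  proof
    assume "E x y"
    with meet that show "sides (F x) \<inter> sides (F y) \<noteq> {}" by blast
  next
    assume "sides (F x) \<inter> sides (F y) \<noteq> {}"
    then obtain e where e: "e \<in> sides (F x)" "e \<in> sides (F y)" by blast
    obtain u v where uv: "convex_polygon (F x) u" "convex_polygon (F y) v"
      using poly \<open>x \<in> V\<close> \<open>y \<in> V\<close> by metis
    have "e \<noteq> {}" "e \<subseteq> region (F x)" "e \<subseteq> region (F y)"
      using convex_polygon.side_nonempty[OF uv(1) e(1)]
        convex_polygon.side_subset_region[OF uv(1) e(1)]
        convex_polygon.side_subset_region[OF uv(2) e(2)] by auto
    then show "E x y" using disj[OF that] by blast
  qed
  \<comment> \<open>A repeated polygon would have its region as one of its own sides if the classes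
    differ, and a region disjoint from itself otherwise.\<close>
  have inj: "inj_on F V"
  proof (rule inj_onI, rule ccontr)
    fix x y assume xy: "x \<in> V" "y \<in> V" "F x = F y" "x \<noteq> y"
    obtain w where w: "convex_polygon (F x) w" using poly[OF xy(1)] by blast
    show False
    proof (cases "E x y")
      case True
      with meet[of x y] xy have "region (F x) \<in> sides (F x)" by simp
      with convex_polygon.region_notin_sides[OF w] show False by contradiction
    next
      case False
      with disj[of x y] xy have "region (F x) = {}" by simp
      with convex_polygon.rel_interior_region_nonempty[OF w] show False by simp
    qed
  qed
  have no_three: "\<not> E x y \<or> \<not> E x z \<or> \<not> E y z" for x y z
    by (auto simp: E_def)
  show "convex_polyhedral_surface \<S>"
    unfolding convex_polyhedral_surface_def polyhedral_surface_def
  proof (intro conjI ballI impI)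
    show "finite \<S>" by (simp add: \<S>_def)
    fix S assume "S \<in> \<S>"
    then obtain x where x: "x \<in> V" "S = F x" by (auto simp: \<S>)
    obtain w where w: "convex_polygon (F x) w" using poly[OF x(1)] by blast
    show "is_polygon S" "strictly_convex_polygon S"
      using convex_polygon.is_polygon[OF w] convex_polygon.strictly_convex_polygon[OF w] x by simp_all
    fix T assume "T \<in> \<S>" "S \<noteq> T"
    then obtain y where y: "y \<in> V" "T = F y" "x \<noteq> y" using x by (auto simp: \<S>)
    have ST: "E x y" if "region S \<inter> region T \<noteq> {}"
      using disj[of x y] that x y by blast
    show "rel_interior (region S) \<inter> rel_interior (region T) = {}"
    proof (cases "E x y")
      case True
      then have "region S \<inter> region T \<in> sides (F x)" using meet x y by blast
      with convex_polygon.rel_interior_Int_side[OF w] x(2)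
      have "rel_interior (region S) \<inter> (region S \<inter> region T) = {}" by simp
      then show ?thesis using rel_interior_subset[of "region T"] rel_interior_subset[of "region S"] by blast
    next
      case False
      with disj x y have "region S \<inter> region T = {}" by blast
      then show ?thesis using rel_interior_subset[of "region T"] rel_interior_subset[of "region S"] by blast
    qed
    show "(\<exists>v \<in> corners S \<inter> corners T. region S \<inter> region T = {v}) \<or>
        region S \<inter> region T \<in> sides S \<inter> sides T" if "region S \<inter> region T \<noteq> {}"
      using meet[of x y] ST[OF that] x y by blast
    fix U assume "U \<in> \<S>" "S \<noteq> U" "T \<noteq> U"
    then obtain z where z: "z \<in> V" "U = F z" "x \<noteq> z" "y \<noteq> z" using x y by (auto simp: \<S>)
    assume "region S \<inter> region T \<inter> region U \<noteq> {}"
    then have "E x y" "E x z" "E y z"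
      using disj x y z by blast+
    with no_three show "\<exists>v \<in> corners S \<inter> corners T \<inter> corners U.
        region S \<inter> region T \<inter> region U = {v}"
      by blast
  qed
  define G where "G = adjacency_graph \<S>"
  \<comment> \<open>The isomorphism runs from polygons to indices, so the labelling \<open>F\<close>
    has to be inverted.\<close>
  define f where "f = the_inv_into V F"
  have f: "f (F x) = x" if "x \<in> V" for x
    using the_inv_into_f_f[OF inj that] by (simp add: f_def)
  have vG: "pverts G = F ` V" by (simp add: G_def adjacency_graph_def \<S>)
  have aG: "parcs G = map_prod F F ` {(x, y). x \<in> V \<and> y \<in> V \<and> E x y}" (is "_ = map_prod F F ` ?R")
  proof -
    have "parcs G = map_prod F F ` {(x, y). x \<in> V \<and> y \<in> V \<and> F x \<noteq> F y \<and> sides (F x) \<inter> sides (F y) \<noteq> {}}"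
      by (auto simp: G_def adjacency_graph_def \<S> image_iff)
    also have "{(x, y). x \<in> V \<and> y \<in> V \<and> F x \<noteq> F y \<and> sides (F x) \<inter> sides (F y) \<noteq> {}} = ?R"
      using sides_ne inj_onD[OF inj] by (auto simp: E_def)
    finally show ?thesis .
  qed
  have K: "complete_bipartite_graph m n = \<lparr>pverts = V, parcs = ?R\<rparr>"
    by (auto simp: complete_bipartite_graph_def Let_def V_def E_def)
  have fa: "map_prod f f ` parcs G = ?R"
    unfolding aG image_image by (force simp: f)
  have fv: "f ` pverts G = V"
    unfolding vG image_image by (simp add: f)
  define h where "h = \<lparr>iso_verts = f, iso_arcs = map_prod f f, iso_head = snd, iso_tail = fst\<rparr>"
  have "pre_digraph.digraph_isomorphism (with_proj G) h"
    unfolding pre_digraph.digraph_isomorphism_def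
  proof (intro conjI ballI)
    show "wf_digraph (with_proj G)"
      by unfold_locales (auto simp: vG aG)
    show "inj_on (iso_verts h) (verts (with_proj G))"
      by (auto simp: h_def vG f intro!: inj_onI)
    show "inj_on (iso_arcs h) (arcs (with_proj G))"
      by (auto simp: h_def aG f intro!: inj_onI)
  qed (auto simp: h_def)
  moreover have "with_proj (complete_bipartite_graph m n) = app_iso h (with_proj G)"
    by (simp add: app_iso_def h_def with_proj_def K fa fv)
  ultimately show "digraph_iso (with_proj (adjacency_graph \<S>))
      (with_proj (complete_bipartite_graph m n))"
    unfolding digraph_iso_def G_def by blast
qed

section \<open>Polygons with integer corners\<close>

type_synonym triple = "int \<times> int \<times> int"

text \<open>Integer coordinates make every condition below decidable by evaluation.\<close>

definition real_vec :: "triple \<Rightarrow> real^3" where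
  "real_vec = (\<lambda>(a, b, c). vector [of_int a, of_int b, of_int c])"

fun dot :: "triple \<Rightarrow> triple \<Rightarrow> int" where
  "dot (a, b, c) (x, y, z) = a * x + b * y + c * z"

fun cross :: "triple \<Rightarrow> triple \<Rightarrow> triple" where
  "cross (a, b, c) (x, y, z) = (b * z - c * y, c * x - a * z, a * y - b * x)"

lemma real_vec_inner: "real_vec p \<bullet> real_vec q = of_int (dot p q)"
  by (cases p; cases q) (simp add: real_vec_def inner_vec_def sum_3)

lemma real_vec_inner_cmp [simp]:
  "real_vec p \<bullet> real_vec q = real_vec p \<bullet> real_vec r \<longleftrightarrow> dot p q = dot p r"
  "real_vec p \<bullet> real_vec q < real_vec p \<bullet> real_vec r \<longleftrightarrow> dot p q < dot p r"
  by (simp_all add: real_vec_inner)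

lemma real_vec_eq_0_iff: "real_vec p = 0 \<longleftrightarrow> p = (0, 0, 0)"
  by (cases p) (auto simp: real_vec_def vec_eq_iff forall_3)

lemma dot_diff_right: "dot p (q - r) = dot p q - dot p r"
  by (cases p; cases q; cases r) (simp add: algebra_simps)

lemma dot_cross_self: "dot (cross e m) e = 0"
  by (cases e; cases m) (simp add: algebra_simps)

text \<open>The edge vector crossed with the plane normal lies in the plane direction and is
  orthogonal to the edge; it points outward when the corners run counterclockwise about
  \<open>m\<close>.\<close>

definition outer_normal :: "triple \<Rightarrow> triple list \<Rightarrow> nat \<Rightarrow> triple" where
  "outer_normal m ps i = cross (ps ! (Suc i mod length ps) - ps ! i) m"

text \<open>Each edge is compared with all other corners: left turns alone would also admit star
  polygons, which wind around more than once.\<close>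

definition positively_oriented :: "triple \<Rightarrow> triple list \<Rightarrow> bool" where
  "positively_oriented m ps \<longleftrightarrow>
     m \<noteq> (0, 0, 0) \<and> 3 \<le> length ps \<and> (\<forall>p\<in>set ps. dot m p = dot m (hd ps)) \<and>
     (\<forall>i\<in>{0..<length ps}. \<forall>k\<in>{0..<length ps}.
        k = i \<or> k = Suc i mod length ps \<or>
        dot (outer_normal m ps i) (ps ! k) < dot (outer_normal m ps i) (ps ! i))"

lemma convex_polygon_real_vec:
  assumes "positively_oriented m ps"
  shows "convex_polygon (map real_vec ps) (\<lambda>i. real_vec (outer_normal m ps i))"
proof
  have ge: "3 \<le> length ps" using assms by (simp add: positively_oriented_def)
  then show "3 \<le> length (map real_vec ps)" by simp
  have "set (map real_vec ps) \<subseteq> {x. real_vec m \<bullet> x = real_vec m \<bullet> real_vec (hd ps)}"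
    using assms by (auto simp: positively_oriented_def)
  then have "aff_dim (set (map real_vec ps)) \<le> aff_dim {x. real_vec m \<bullet> x = real_vec m \<bullet> real_vec (hd ps)}"
    by (rule aff_dim_subset)
  also have "\<dots> = 2"
    using assms by (simp add: positively_oriented_def real_vec_eq_0_iff)
  finally show "aff_dim (set (map real_vec ps)) \<le> 2" .
  fix i assume i: "i < length (map real_vec ps)"
  have lt: "Suc i mod length ps < length ps" using ge by (intro mod_less_divisor) linarith
  show "real_vec (outer_normal m ps i) \<bullet> map real_vec ps ! (Suc i mod length (map real_vec ps)) =
      real_vec (outer_normal m ps i) \<bullet> map real_vec ps ! i"
    using i lt dot_cross_self[of "ps ! (Suc i mod length ps) - ps ! i" m]
    by (simp add: dot_diff_right outer_normal_def)
  fix k assume k: "k < length (map real_vec ps)" "k \<noteq> i" "k \<noteq> Suc i mod length (map real_vec ps)"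
  then have "i \<in> {0..<length ps}" "k \<in> {0..<length ps}" "k \<noteq> Suc i mod length ps"
    using i by auto
  then have "dot (outer_normal m ps i) (ps ! k) < dot (outer_normal m ps i) (ps ! i)"
    using assms k(2) unfolding positively_oriented_def by blast
  with i k show "real_vec (outer_normal m ps i) \<bullet> map real_vec ps ! k <
      real_vec (outer_normal m ps i) \<bullet> map real_vec ps ! i"
    by simp
qed

definition separated :: "triple \<Rightarrow> triple list \<Rightarrow> triple list \<Rightarrow> bool" where
  "separated u ps qs \<longleftrightarrow> (\<forall>p\<in>set ps. \<forall>q\<in>set qs. dot u p < dot u q)"

lemma separated_disjoint:
  assumes "separated u ps qs"
  shows "convex hull (real_vec ` set ps) \<inter> convex hull (real_vec ` set qs) = {}"
proof -
  have "real_vec u \<bullet> x < real_vec u \<bullet> y"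
    if x: "x \<in> convex hull (real_vec ` set ps)" and y: "y \<in> convex hull (real_vec ` set qs)" for x y
  proof (rule convex_hull_inner_gt[OF _ y])
    fix q assume "q \<in> real_vec ` set qs"
    then show "real_vec u \<bullet> x < real_vec u \<bullet> q"
      using assms by (intro convex_hull_inner_less[OF _ x]) (auto simp: separated_def)
  qed
  then show ?thesis by blast
qed

text \<open>The common edge is compared as an unordered pair, since the two polygons may traverse it
  in opposite directions.\<close>

definition touches_along_side :: "triple \<Rightarrow> triple list \<Rightarrow> triple list \<Rightarrow> bool" where
  "touches_along_side m ps qs \<longleftrightarrow>
     (\<forall>p\<in>set ps. dot m p = dot m (hd ps)) \<and>
     (\<exists>i\<in>{0..<length ps}. \<exists>j\<in>{0..<length qs}.
        {ps ! i, ps ! (Suc i mod length ps)} = {qs ! j, qs ! (Suc j mod length qs)} \<and>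
        (\<forall>q\<in>set qs. q = qs ! j \<or> q = qs ! (Suc j mod length qs) \<or> dot m (hd ps) < dot m q))"

text \<open>The plane of \<open>P\<close> supports the hull of \<open>Q\<close> and meets it only in
  the common edge, which also belongs to \<open>P\<close>.\<close>

lemma touches_along_side_Int:
  fixes m ps qs
  defines "P \<equiv> map real_vec ps" and "Q \<equiv> map real_vec qs"
  assumes "touches_along_side m ps qs"
  shows "convex hull set P \<inter> convex hull set Q \<in> sides P \<inter> sides Q"
proof -
  obtain i j where ij: "i < length ps" "j < length qs"
    and eq: "{ps ! i, ps ! (Suc i mod length ps)} = {qs ! j, qs ! (Suc j mod length qs)}"
    and flat: "\<And>p. p \<in> set ps \<Longrightarrow> dot m p = dot m (hd ps)"
    and above: "\<And>q. q \<in> set qs \<Longrightarrow>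
      q = qs ! j \<or> q = qs ! (Suc j mod length qs) \<or> dot m (hd ps) < dot m q"
    using assms(3) unfolding touches_along_side_def by auto
  define p p' where "p = ps ! i" and "p' = ps ! (Suc i mod length ps)"
  have lt: "Suc i mod length ps < length ps" "Suc j mod length qs < length qs"
    using ij by (auto intro!: mod_less_divisor)
  have mem: "p \<in> set ps" "p' \<in> set ps" "p \<in> set qs" "p' \<in> set qs"
    using ij lt eq nth_mem by (auto simp: p_def p'_def doubleton_eq_iff)
  have above': "q \<in> {p, p'} \<or> dot m (hd ps) < dot m q" if "q \<in> set qs" for q
    using above[OF that] eq unfolding p_def p'_def by blast
  have ge: "dot m (hd ps) \<le> dot m q" if "q \<in> set qs" for q
    using above'[OF that] flat[OF mem(1)] flat[OF mem(2)] by auto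
  define e where "e = closed_segment (real_vec p) (real_vec p')"
  have "e \<in> sides P"
    using ij lt by (auto simp: sides_def P_def e_def p_def p'_def intro!: exI[of _ i])
  moreover have "e \<in> sides Q"
    using ij lt eq by (auto simp: sides_def Q_def e_def p_def p'_def doubleton_eq_iff
        closed_segment_commute intro!: exI[of _ j])
  moreover have "convex hull set P \<inter> convex hull set Q = e"
  proof
    let ?H = "{x. real_vec m \<bullet> x = real_vec m \<bullet> real_vec (hd ps)}"
    have "convex hull set P \<subseteq> ?H"
      using flat by (intro hull_minimal convex_hyperplane) (auto simp: P_def)
    moreover have "convex hull set Q \<inter> ?H = convex hull (set Q \<inter> ?H)"
    proof -
      \<comment> \<open>The plane bounds \<open>Q\<close> from below, while the hyperplane lemma
        concerns maxima; hence the signs.\<close>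
      have "- real_vec m \<bullet> v \<le> - (real_vec m \<bullet> real_vec (hd ps))" if "v \<in> set Q" for v
        using that ge by (auto simp: Q_def real_vec_inner)
      from convex_hull_Int_supporting_hyperplane(1)[of "set Q", OF _ this]
      show ?thesis by simp
    qed
    moreover have "set Q \<inter> ?H \<subseteq> {real_vec p, real_vec p'}"
    proof
      fix v assume "v \<in> set Q \<inter> ?H"
      then obtain q where "q \<in> set qs" "v = real_vec q" "dot m q = dot m (hd ps)"
        by (auto simp: Q_def)
      with above'[of q] show "v \<in> {real_vec p, real_vec p'}" by auto
    qed
    then have "convex hull (set Q \<inter> ?H) \<subseteq> e"
      unfolding e_def segment_convex_hull by (rule hull_mono)
    ultimately show "convex hull set P \<inter> convex hull set Q \<subseteq> e" by blast
    show "e \<subseteq> convex hull set P \<inter> convex hull set Q"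
      unfolding e_def segment_convex_hull using mem by (auto simp: P_def Q_def intro!: hull_mono)
  qed
  ultimately show ?thesis by simp
qed

section \<open>The realization\<close>

fun rot :: "triple \<Rightarrow> triple" where
  "rot (x, y, z) = (z, x, y)"

text \<open>Each corner list is paired with a normal of its plane, around which it runs counterclockwise.\<close>

definition decagons :: "(triple \<times> triple list) list" where
  "decagons =
    (let ps = [(0,29,27), (0,28,28), (0,3,33), (0,1,30), (0,3,19), (0,4,18), (0,18,7),
               (0,21,5), (0,34,15), (0,35,16)]
     in [((1,0,0), ps), ((0,1,0), map rot ps), ((0,0,1), map (rot \<circ> rot) ps)])"

text \<open>The first two lie in the planes x + y + z = 56 and x + y + z = 22. Every second side of
  a decagon is used, one for each hexagon.\<close>

definition hexagons :: "(triple \<times> triple list) list" where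
  "hexagons =
    (let ps = [(0,1,30), (0,3,33), (35,16,0), (34,15,0), (7,0,18), (5,0,21)]
     in [((1,1,1), [(0,29,27), (0,28,28), (27,0,29), (28,0,28), (29,27,0), (28,28,0)]),
         ((1,1,1), [(0,4,18), (0,3,19), (18,0,4), (19,0,3), (4,18,0), (3,19,0)]),
         ((-3,3,-2), ps), ((-2,-3,3), map rot ps), ((3,-2,-3), map (rot \<circ> rot) ps)])"

text \<open>A common pool. (-1,-1,-1) splits the first hexagon from all others, and (1,0,0), (0,1,0)
  split the decagons. The next three split the second hexagon from the rotated ones. The last three,
  one orbit under \<open>rot\<close> up to sign, split those from each other; the final sign is
  reversed because the cyclic order wraps around in the list.\<close>

definition separating_normals :: "triple list" where
  "separating_normals = [(-1,-1,-1), (1,0,0), (0,1,0), (1,0,1), (1,1,0), (0,1,1),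
     (-24,-7,-42), (-42,-24,-7), (7,42,24)]"

lemma decagons_oriented: "\<forall>(m, ps)\<in>set decagons. positively_oriented m ps"
  by code_simp

lemma hexagons_oriented: "\<forall>(m, ps)\<in>set hexagons. positively_oriented m ps"
  by code_simp

definition separable :: "(triple \<times> triple list) list \<Rightarrow> bool" where
  "separable = sorted_wrt (\<lambda>(_, ps) (_, qs). \<exists>u\<in>set separating_normals. separated u ps qs)"

lemma separable_decagons: "separable decagons"
  by code_simp

lemma separable_hexagons: "separable hexagons"
  by code_simp

lemma decagons_touch_hexagons:
  "\<forall>(m, ps)\<in>set decagons. \<forall>(k, qs)\<in>set hexagons. touches_along_side m ps qs"
  by code_simp

theorem proposition9:
  shows "\<exists>\<S>. convex_polyhedral_surface \<S> \<and>
    digraph_iso (with_proj (adjacency_graph \<S>)) (with_proj (complete_bipartite_graph 3 5))"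
proof -
  \<comment> \<open>Only the corners enter the surface; the paired normals serve the checks.\<close>
  define corner_list where "corner_list pss i = map real_vec (snd (pss ! i))" for pss :: "(triple \<times> triple list) list" and i
  have len: "length decagons = 3" "length hexagons = 5"
    by (simp_all add: decagons_def hexagons_def Let_def)
  have poly: "\<exists>w. convex_polygon (corner_list pss i) w"
    if "\<forall>(m, ps)\<in>set pss. positively_oriented m ps" "i < length pss" for pss i
    using that convex_polygon_real_vec nth_mem[OF that(2)]
    unfolding corner_list_def by (metis (no_types, lifting) case_prod_unfold)
  have region: "region (corner_list pss i) = convex hull (set (corner_list pss i))"
    if "\<forall>(m, ps)\<in>set pss. positively_oriented m ps" "i < length pss" for pss i
    using poly[OF that] convex_polygon.region_eq by blast
  have disj: "region (corner_list pss i) \<inter> region (corner_list pss j) = {}"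
    if oriented: "\<forall>(m, ps)\<in>set pss. positively_oriented m ps" and sep: "separable pss"
      and ij: "i < j" "j < length pss" for pss i j
  proof -
    obtain u where "separated u (snd (pss ! i)) (snd (pss ! j))"
      using sorted_wrt_nth_less[OF sep[unfolded separable_def] ij]
      unfolding case_prod_unfold by blast
    from separated_disjoint[OF this] show ?thesis
      using region[OF oriented] ij by (simp add: corner_list_def)
  qed
  have touch: "region (corner_list decagons i) \<inter> region (corner_list hexagons j)
      \<in> sides (corner_list decagons i) \<inter> sides (corner_list hexagons j)" if "i < 3" "j < 5" for i j
  proof -
    have "touches_along_side (fst (decagons ! i)) (snd (decagons ! i)) (snd (hexagons ! j))"
      using decagons_touch_hexagons nth_mem[of i decagons] nth_mem[of j hexagons] that len
      by (auto simp: case_prod_unfold)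
    from touches_along_side_Int[OF this] show ?thesis
      using that region decagons_oriented hexagons_oriented len by (simp add: corner_list_def)
  qed
  show ?thesis
    using complete_bipartite_surface[of 3 "corner_list decagons" 5 "corner_list hexagons"]
      poly[OF decagons_oriented] poly[OF hexagons_oriented]
      disj[OF decagons_oriented separable_decagons] disj[OF hexagons_oriented separable_hexagons]
      touch len by auto
qed

end
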